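(* Let $G$ be a totally disconnected locally compact group. (1) If $\alpha:G\to G$ is a continuous endomorphism, then $\alpha$ is topologically expanding if and only if it is positively expansive. (2) If $\alpha$ is a topological automorphism of $G$, then $\alpha$ is topologically Anosov if and only if it is expansive.
   Context: All topological spaces are Hausdorff. Let $G$ be a topological group with identity $e$ and $\alpha$ a continuous endomorphism of $G$. For a neighbourhood $V$ of $e$, a sequence $(x_k)_{k\ge 0}$ in $G$ is a $V$-pseudo-orbit if $\alpha(x_k)^{-1}x_{k+1}\in V$ for all $k\ge 0$; for a neighbourhood $U$ of $e$ it is $U$-shadowed by $x\in G$ if $\alpha^k(x)^{-1}x_k\in U$ for all $k\ge 0$. The endomorphism $\alpha$ has shadowing if for every neighbourhood $U$ of $e$ there is a neighbourhood $V$ of $e$ such that every one-sided infinite $V$-pseudo-orbit is $U$-shadowed by some point of $G$. If $\alpha$ is a topological automorphism, it has two-sided shadowing if for every neighbourhood $U$ of $e$ there is a neighbourhood $V$ of $e$ such that for every $(x_k)_{k\in\mathbb Z}$ in $G$ with $\alpha(x_k)^{-1}x_{k+1}\in V$ for all $k\in\mathbb Z$ there is $x\in G$ with $\alpha^k(x)^{-1}x_k\in U$ for all $k\in\mathbb Z$. An endomorphism $\alpha$ is positively expansive if there is a neighbourhood $U$ of $e$ with $\bigcap_{n\ge 0}\alpha^{-n}(U)=\{e\}$; an automorphism $\alpha$ is expansive if there is a neighbourhood $U$ of $e$ with $\bigcap_{n\in\mathbb Z}\alpha^{-n}(U)=\{e\}$. An endomorphism is topologically expanding if it is positively expansive and has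 shadowing; an automorphism is topologically Anosov if it is expansive and has two-sided shadowing. *)

theory Defs
  imports "HOL-Analysis.Analysis"
begin

text \<open>Groups are written additively, following the class \<^class>\<open>topological_group_add\<close>, which does
  not assume commutativity: \<open>0\<close> is the identity and \<open>- a + b\<close> stands for $a^{-1}b$.\<close>

text \<open>Neighbourhoods are not required to be open.\<close>

definition nbhd_of_identity :: "'a::topological_group_add set \<Rightarrow> bool" where
  "nbhd_of_identity U \<longleftrightarrow> 0 \<in> interior U"

definition totally_disconnected_space :: "'a topology \<Rightarrow> bool" where
  "totally_disconnected_space X \<longleftrightarrow> (\<forall>x\<in>topspace X. connected_component_of_set X x = {x})"

definition continuous_endomorphism :: "('a::topological_group_add \<Rightarrow> 'a) \<Rightarrow> bool" where
  "continuous_endomorphism \<alpha> \<longleftrightarrow>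
     (\<forall>x y. \<alpha> (x + y) = \<alpha> x + \<alpha> y) \<and> continuous_on UNIV \<alpha>"

definition topological_automorphism :: "('a::topological_group_add \<Rightarrow> 'a) \<Rightarrow> bool" where
  "topological_automorphism \<alpha> \<longleftrightarrow>
     (\<forall>x y. \<alpha> (x + y) = \<alpha> x + \<alpha> y) \<and> homeomorphism UNIV UNIV \<alpha> (inv \<alpha>)"

text \<open>The iterate $\alpha^k$ for an integer $k$; only meaningful for bijective \<open>\<alpha>\<close>.\<close>

definition int_iterate :: "('a \<Rightarrow> 'a) \<Rightarrow> int \<Rightarrow> 'a \<Rightarrow> 'a" where
  "int_iterate \<alpha> k = (if 0 \<le> k then \<alpha> ^^ nat k else inv \<alpha> ^^ nat (- k))"

definition pseudo_orbit ::
  "('a::topological_group_add \<Rightarrow> 'a) \<Rightarrow> 'a set \<Rightarrow> (nat \<Rightarrow> 'a) \<Rightarrow> bool" where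
  "pseudo_orbit \<alpha> V x \<longleftrightarrow> (\<forall>k. - \<alpha> (x k) + x (Suc k) \<in> V)"

definition shadowed_by ::
  "('a::topological_group_add \<Rightarrow> 'a) \<Rightarrow> 'a set \<Rightarrow> (nat \<Rightarrow> 'a) \<Rightarrow> 'a \<Rightarrow> bool" where
  "shadowed_by \<alpha> U x z \<longleftrightarrow> (\<forall>k. - (\<alpha> ^^ k) z + x k \<in> U)"

definition has_shadowing :: "('a::topological_group_add \<Rightarrow> 'a) \<Rightarrow> bool" where
  "has_shadowing \<alpha> \<longleftrightarrow>
     (\<forall>U. nbhd_of_identity U \<longrightarrow>
       (\<exists>V. nbhd_of_identity V \<and> (\<forall>x. pseudo_orbit \<alpha> V x \<longrightarrow> (\<exists>z. shadowed_by \<alpha> U x z))))"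

definition has_two_sided_shadowing :: "('a::topological_group_add \<Rightarrow> 'a) \<Rightarrow> bool" where
  "has_two_sided_shadowing \<alpha> \<longleftrightarrow>
     (\<forall>U. nbhd_of_identity U \<longrightarrow>
       (\<exists>V. nbhd_of_identity V \<and>
         (\<forall>x :: int \<Rightarrow> 'a. (\<forall>k. - \<alpha> (x k) + x (k + 1) \<in> V) \<longrightarrow>
            (\<exists>z. \<forall>k. - int_iterate \<alpha> k z + x k \<in> U))))"

definition positively_expansive :: "('a::topological_group_add \<Rightarrow> 'a) \<Rightarrow> bool" where
  "positively_expansive \<alpha> \<longleftrightarrow>
     (\<exists>U. nbhd_of_identity U \<and> (\<Inter>n::nat. (\<alpha> ^^ n) -` U) = {0})"

definition expansive :: "('a::topological_group_add \<Rightarrow> 'a) \<Rightarrow> bool" where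
  "expansive \<alpha> \<longleftrightarrow>
     (\<exists>U. nbhd_of_identity U \<and> (\<Inter>n::int. int_iterate \<alpha> n -` U) = {0})"

definition topologically_expanding :: "('a::topological_group_add \<Rightarrow> 'a) \<Rightarrow> bool" where
  "topologically_expanding \<alpha> \<longleftrightarrow> positively_expansive \<alpha> \<and> has_shadowing \<alpha>"

definition topologically_Anosov :: "('a::topological_group_add \<Rightarrow> 'a) \<Rightarrow> bool" where
  "topologically_Anosov \<alpha> \<longleftrightarrow> expansive \<alpha> \<and> has_two_sided_shadowing \<alpha>"

end

theory Submission
  imports Defs
begin

text \<open>Let \<open>W\<close> be a compact open subgroup and \<open>W\<^sub>p\<close> the subgroup of points whose first \<open>p\<close> iterates
  lie in \<open>W\<close>. For large \<open>p\<close>, every element of \<open>\<alpha>^(p+1) W\<^sub>p\<close> agrees modulo \<open>W\<close> with one of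
  \<open>\<alpha>^(p+n+1) W\<^sub>p\<^sub>+\<^sub>n\<close>: a finite type condition. So if \<open>z\<close> shadows a \<open>W\<^sub>p\<close>-pseudo-orbit up to time \<open>N\<close>,
  it can be corrected by an element of \<open>W\<^sub>p\<^sub>+\<^sub>N\<close> to shadow up to time \<open>N + 1\<close>, with the same \<open>W\<^sub>p\<close>.
  Expansivity is used only to make such subgroups arbitrarily small.\<close>

section \<open>Subgroups and decreasing sequences of compact sets\<close>

definition additive_subgroup :: "'a::group_add set \<Rightarrow> bool" where
  "additive_subgroup W \<longleftrightarrow> 0 \<in> W \<and> (\<forall>x\<in>W. \<forall>y\<in>W. - x + y \<in> W)"

lemma additive_subgroup_zero: "additive_subgroup W \<Longrightarrow> 0 \<in> W"
  by (simp add: additive_subgroup_def)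

lemma additive_subgroup_minus_add:
  "additive_subgroup W \<Longrightarrow> x \<in> W \<Longrightarrow> y \<in> W \<Longrightarrow> - x + y \<in> W"
  by (simp add: additive_subgroup_def)

lemma additive_subgroup_add:
  assumes "additive_subgroup W" "x \<in> W" "y \<in> W"
  shows "x + y \<in> W"
proof -
  have "- x + 0 \<in> W"
    using assms additive_subgroup_zero additive_subgroup_minus_add by blast
  then have "- (- x + 0) + y \<in> W"
    using assms additive_subgroup_minus_add by blast
  then show ?thesis by simp
qed

lemma compact_decseq_Inter_nonempty:
  fixes F :: "nat \<Rightarrow> 'a::t2_space set"
  assumes "\<And>n. compact (F n)" "\<And>n. F n \<noteq> {}" "decseq F"
  shows "(\<Inter>n. F n) \<noteq> {}"
proof -
  have "F 0 \<inter> (\<Inter>n\<in>UNIV. F n) \<noteq> {}"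
  proof (rule compact_imp_fip_image)
    show "compact (F 0)" "\<And>n. closed (F n)"
      using assms(1) by (auto intro: compact_imp_closed)
    fix I :: "nat set"
    assume "finite I"
    then obtain n where "\<forall>i\<in>I. i \<le> n"
      using finite_nat_set_iff_bounded_le by blast
    then have "F n \<subseteq> F 0 \<inter> (\<Inter>i\<in>I. F i)"
      using \<open>decseq F\<close> by (auto simp: decseq_def)
    then show "F 0 \<inter> (\<Inter>i\<in>I. F i) \<noteq> {}"
      using assms(2)[of n] by blast
  qed
  then show ?thesis by blast
qed

text \<open>Otherwise the sets \<open>F n - V\<close> would be nonempty, compact and decreasing,
  hence share a point, which would lie in the intersection but outside \<open>V\<close>. This is the
  source of the threshold \<open>p0\<close> and of the small subgroups inside
  \<open>U\<close>.\<close>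

lemma compact_decseq_Inter_subset_open:
  fixes F :: "nat \<Rightarrow> 'a::t2_space set"
  assumes "\<And>n. compact (F n)" "decseq F" "open V" "(\<Inter>n. F n) \<subseteq> V"
  obtains n where "F n \<subseteq> V"
proof (rule ccontr)
  assume "\<not> thesis"
  then have "F n - V \<noteq> {}" for n
    using that by blast
  moreover have "compact (F n - V)" for n
    using assms(1,3) by (simp add: compact_diff)
  moreover have "decseq (\<lambda>n. F n - V)"
    using \<open>decseq F\<close> by (auto simp: decseq_def)
  ultimately have "(\<Inter>n. F n - V) \<noteq> {}"
    by (intro compact_decseq_Inter_nonempty) auto
  then show False
    using assms(4) by blast
qed

section \<open>Compact open subgroups\<close>

lemma continuous_on_left_translation:
  "continuous_on S (\<lambda>x. c + x :: 'a::topological_group_add)"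
  by (intro continuous_intros)

text \<open>The subgroup is the stabiliser of a compact open neighbourhood of the identity under right
  translation.\<close>

lemma van_Dantzig:
  fixes U :: "'a::{topological_group_add, t2_space} set"
  assumes td: "totally_disconnected_space (euclidean :: 'a topology)"
    and lc: "locally_compact_space (euclidean :: 'a topology)"
    and U: "nbhd_of_identity U"
  obtains W where "additive_subgroup W" "open W" "compact W" "W \<subseteq> U"
proof -
  obtain O1 K :: "'a set" where K: "open O1" "compact K" "0 \<in> O1" "O1 \<subseteq> K"
    using bspec[OF lc[unfolded locally_compact_space_def], of 0] by auto
  have "{0} \<in> connected_components_of (euclidean :: 'a topology)"
    using td by (auto simp: totally_disconnected_space_def connected_components_of_def image_iff
        intro!: exI[of _ 0])
  moreover have "Hausdorff_space (euclidean :: 'a topology)"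
    unfolding Hausdorff_space_def disjnt_def open_openin[symmetric]
    by (intro allI impI hausdorff) simp
  moreover have "openin euclidean (O1 \<inter> interior U)" "{0} \<subseteq> O1 \<inter> interior U"
    using K U by (auto simp: nbhd_of_identity_def)
  \<comment> \<open>In a locally compact Hausdorff space a compact component has a clopen
    neighbourhood inside any open set containing it. The component here is \<open>{0}\<close>, and
    \<open>C \<subseteq> O1 \<subseteq> K\<close> will make \<open>C\<close> compact.\<close>
  ultimately obtain C D where CD: "open C" "open D" "C \<inter> D = {}" "C \<union> D = UNIV"
      "0 \<in> C" "C \<subseteq> O1 \<inter> interior U"
    using lc wilder_locally_compact_component_thm[of "euclidean :: 'a topology" "{0}" "O1 \<inter> interior U"]
    by (auto simp: disjnt_def)
  have "C = - D" using CD by blast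
  then have "closed C" using \<open>open D\<close> by (simp add: closed_Compl)
  then have "compact C"
    using K CD compact_Int_closed[of K C] by (metis inf.absorb2 le_inf_iff order_trans)
  \<comment> \<open>Requiring stability under both \<open>w\<close> and \<open>- w\<close> makes
    closure under inverses immediate. Testing with \<open>c = 0\<close> gives
    \<open>W \<subseteq> C\<close>.\<close>
  define W where "W = {w. (\<forall>c\<in>C. c + w \<in> C) \<and> (\<forall>c\<in>C. c - w \<in> C)}"
  have "additive_subgroup W"
    unfolding additive_subgroup_def W_def
    by (auto simp: diff_add_eq_diff_diff_swap simp flip: add.assoc)
  moreover have "W \<subseteq> C" using \<open>0 \<in> C\<close> by (auto simp: W_def)
  moreover have "open W"
  proof -
    \<comment> \<open>In a pair, the first entry is the translating element and the second a point
      of \<open>C\<close>. Since \<open>C\<close> is compact, the tube lemma yields one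
      neighbourhood \<open>X\<close> of \<open>0\<close> that works for all of \<open>C\<close>, so
      \<open>X \<subseteq> W\<close>; left translation by points of \<open>W\<close> then makes
      \<open>W\<close> open.\<close>
    let ?T = "{p. snd p + fst p \<in> C} \<inter> {p. snd p - fst p \<in> C}"
    have "open ((\<lambda>p::'a\<times>'a. snd p + fst p) -` C)" "open ((\<lambda>p::'a\<times>'a. snd p - fst p) -` C)"
      using \<open>open C\<close> by (auto intro!: open_vimage continuous_intros)
    then have T: "open ?T" by (auto simp: vimage_def)
    have "{0} \<times> C \<subseteq> ?T" by auto
    then obtain X where X: "0 \<in> X" "open X" "X \<times> C \<subseteq> ?T"
      using Elementary_Topology.tube_lemma[OF \<open>compact C\<close> T] by blast
    then have XW: "X \<subseteq> W" by (auto simp: W_def)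
    have "\<exists>T. open T \<and> w \<in> T \<and> T \<subseteq> W" if "w \<in> W" for w
    proof (intro exI conjI)
      show "open ((+) (- w) -` X)"
        by (intro open_vimage X continuous_on_left_translation)
      show "w \<in> (+) (- w) -` X" using X by simp
      show "(+) (- w) -` X \<subseteq> W"
      proof
        fix y assume "y \<in> (+) (- w) -` X"
        then have "w + (- w + y) \<in> W"
          using XW that additive_subgroup_add[OF \<open>additive_subgroup W\<close>] by blast
        then show "y \<in> W" by (simp flip: add.assoc)
      qed
    qed
    then show ?thesis by (subst open_subopen) blast
  qed
  moreover have "compact W"
  proof -
    \<comment> \<open>The complement of \<open>W\<close> is a union of left cosets
      \<open>y + W\<close>, so the open subgroup \<open>W\<close> is also closed.\<close>
    have "- W = (\<Union>y\<in>-W. (+) (- y) -` W)"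
    proof safe
      fix x assume "x \<notin> W"
      then show "x \<in> (\<Union>y\<in>-W. (+) (- y) -` W)"
        using additive_subgroup_zero[OF \<open>additive_subgroup W\<close>] by (auto intro!: bexI[of _ x])
    next
      fix x y assume *: "y \<notin> W" "x \<in> W" "- y + x \<in> W"
      then have "- (- y + x) \<in> W"
        using additive_subgroup_minus_add[OF \<open>additive_subgroup W\<close>, of "- y + x" 0]
          additive_subgroup_zero[OF \<open>additive_subgroup W\<close>] by simp
      then have "x + - (- y + x) \<in> W"
        using * \<open>additive_subgroup W\<close> by (intro additive_subgroup_add)
      then show False using * by (simp add: minus_add flip: add.assoc)
    qed
    moreover have "open (\<Union>y\<in>-W. (+) (- y) -` W)"
      by (intro open_UN ballI open_vimage \<open>open W\<close> continuous_on_left_translation)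
    ultimately have "closed W" by (simp add: closed_def)
    then show ?thesis
      using \<open>compact C\<close> \<open>W \<subseteq> C\<close> by (metis compact_Int_closed inf.absorb2)
  qed
  moreover have "W \<subseteq> U"
    using \<open>W \<subseteq> C\<close> CD interior_subset by blast
  ultimately show thesis using that by blast
qed

section \<open>Continuous endomorphisms and the subgroups \<open>stay\<close>\<close>

lemma continuous_endomorphism_add:
  "continuous_endomorphism f \<Longrightarrow> f (x + y) = f x + f y"
  by (simp add: continuous_endomorphism_def)

lemma continuous_endomorphism_zero:
  assumes "continuous_endomorphism f"
  shows "f 0 = 0"
  using continuous_endomorphism_add[OF assms, of 0 0] 
  by (metis add.right_neutral add_left_cancel)

lemma continuous_endomorphism_minus:
  assumes "continuous_endomorphism f"
  shows "f (- x) = - f x"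
  using continuous_endomorphism_add[OF assms, of x "- x"] continuous_endomorphism_zero[OF assms]
  by (simp add: eq_neg_iff_add_eq_0 neg_eq_iff_add_eq_0 minus_unique)

lemma continuous_endomorphism_continuous_on:
  "continuous_endomorphism f \<Longrightarrow> continuous_on S f"
  using continuous_on_subset by (auto simp: continuous_endomorphism_def)

lemma continuous_endomorphism_funpow:
  assumes "continuous_endomorphism f"
  shows "continuous_endomorphism (f ^^ n)"
proof (induction n)
  case 0
  then show ?case by (simp add: continuous_endomorphism_def id_def)
next
  case (Suc n)
  then show ?case
    using assms continuous_on_compose[of UNIV "f ^^ n" f] continuous_on_subset
    unfolding continuous_endomorphism_def by (auto simp: o_def)
qed

text \<open>These are the subgroups \<open>W\<^sub>p\<close> of the overview. The bound is
  inclusive, so index \<open>0\<close> gives \<open>W\<close> itself and \<open>n + 1\<close> is the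
  first time at which nothing is required.\<close>

definition stay :: "('a \<Rightarrow> 'a) \<Rightarrow> 'a set \<Rightarrow> nat \<Rightarrow> 'a set" where
  "stay \<alpha> W n = {x. \<forall>i\<le>n. (\<alpha> ^^ i) x \<in> W}"

lemma decseq_stay: "decseq (stay \<alpha> W)"
  by (auto simp: decseq_def stay_def)

lemma stay_eq_INT: "stay \<alpha> W n = (\<Inter>i\<in>{..n}. (\<alpha> ^^ i) -` W)"
  by (auto simp: stay_def)

lemma additive_subgroup_stay:
  assumes "continuous_endomorphism \<alpha>" "additive_subgroup W"
  shows "additive_subgroup (stay \<alpha> W n)"
  using assms(2) unfolding additive_subgroup_def stay_def
  by (auto simp: continuous_endomorphism_add[OF continuous_endomorphism_funpow[OF assms(1)]]
      continuous_endomorphism_zero[OF continuous_endomorphism_funpow[OF assms(1)]]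
      continuous_endomorphism_minus[OF continuous_endomorphism_funpow[OF assms(1)]])

lemma open_stay:
  assumes "continuous_endomorphism \<alpha>" "open W"
  shows "open (stay \<alpha> W n)"
  unfolding stay_eq_INT
  by (intro open_INT open_vimage ballI finite_atMost assms(2)
      continuous_endomorphism_continuous_on continuous_endomorphism_funpow assms(1))

lemma compact_stay:
  fixes W :: "'a::{topological_group_add, t2_space} set"
  assumes "continuous_endomorphism \<alpha>" "compact W"
  shows "compact (stay \<alpha> W n)"
proof -
  have "closed (stay \<alpha> W n)"
    unfolding stay_eq_INT
    by (intro closed_INT closed_vimage ballI compact_imp_closed assms(2)
        continuous_endomorphism_continuous_on continuous_endomorphism_funpow assms(1))
  moreover have "stay \<alpha> W n \<subseteq> W"
    by (force simp: stay_def)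
  ultimately show ?thesis
    using compact_Int_closed[OF assms(2)] by (metis inf.absorb2)
qed

text \<open>The compact sets \<open>\<alpha>^(n+1) (stay \<alpha> W n)\<close> decrease, so modulo the open subgroup \<open>W\<close> they
  are eventually constant.\<close>

lemma stay_image_stabilises:
  fixes W :: "'a::{topological_group_add, t2_space} set"
  assumes \<alpha>: "continuous_endomorphism \<alpha>"
    and W: "additive_subgroup W" "open W" "compact W"
  obtains p0 where "\<And>p n a. p0 \<le> p \<Longrightarrow> a \<in> stay \<alpha> W p \<Longrightarrow>
    \<exists>b\<in>stay \<alpha> W (p + n). - (\<alpha> ^^ (Suc (p + n))) b + (\<alpha> ^^ (Suc p)) a \<in> W"
proof -
  \<comment> \<open>The exponent is the first unconstrained time. If \<open>x\<close> stays up to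
    time \<open>n + 1\<close>, then \<open>\<alpha> x\<close> stays up to time \<open>n\<close> and
    has the same image, so the sets decrease.\<close>
  define A where "A n = (\<alpha> ^^ Suc n) ` stay \<alpha> W n" for n
  have "compact (A n)" for n
    unfolding A_def
    by (intro compact_continuous_image continuous_endomorphism_continuous_on
        continuous_endomorphism_funpow \<alpha> compact_stay W)
  moreover have "decseq A"
  proof (rule decseq_SucI)
    fix n
    show "A (Suc n) \<subseteq> A n"
    proof
      fix y assume "y \<in> A (Suc n)"
      then obtain x where x: "x \<in> stay \<alpha> W (Suc n)" "y = (\<alpha> ^^ Suc (Suc n)) x"
        by (auto simp: A_def)
      then have "\<alpha> x \<in> stay \<alpha> W n"
        using spec[of "\<lambda>i. i \<le> Suc n \<longrightarrow> (\<alpha> ^^ i) x \<in> W" "Suc _"]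
        by (auto simp: stay_def funpow_swap1)
      moreover have "y = (\<alpha> ^^ Suc n) (\<alpha> x)"
        using x by (simp add: funpow_swap1)
      ultimately show "y \<in> A n" by (auto simp: A_def)
    qed
  qed
  \<comment> \<open>This union of cosets \<open>d + W\<close> is an open set around the intersection
    of all \<open>A n\<close>. Once it contains \<open>A p0\<close>, every point of
    \<open>A p0\<close> is congruent modulo \<open>W\<close> to a point lying in every
    \<open>A n\<close>.\<close>
  moreover have "open (\<Union>d\<in>(\<Inter>n. A n). (+) (- d) -` W)"
    by (intro open_UN ballI open_vimage W continuous_on_left_translation)
  moreover have "(\<Inter>n. A n) \<subseteq> (\<Union>d\<in>(\<Inter>n. A n). (+) (- d) -` W)"
    using additive_subgroup_zero[OF W(1)] by force
  ultimately obtain p0 where p0: "A p0 \<subseteq> (\<Union>d\<in>(\<Inter>n. A n). (+) (- d) -` W)"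
    by (rule compact_decseq_Inter_subset_open)
  show thesis
  proof (rule that)
    fix p n a
    assume "p0 \<le> p" "a \<in> stay \<alpha> W p"
    then have "(\<alpha> ^^ Suc p) a \<in> A p0"
      using \<open>decseq A\<close> unfolding A_def decseq_def by blast
    then obtain d where "\<forall>n. d \<in> A n" "- d + (\<alpha> ^^ Suc p) a \<in> W"
      using p0 by auto
    moreover from this obtain b where "b \<in> stay \<alpha> W (p + n)" "d = (\<alpha> ^^ Suc (p + n)) b"
      unfolding A_def by blast
    ultimately show "\<exists>b\<in>stay \<alpha> W (p + n). - (\<alpha> ^^ (Suc (p + n))) b + (\<alpha> ^^ (Suc p)) a \<in> W"
      by blast
  qed
qed

text \<open>The finite type condition corrects the shadowing point one time step at a time without
  enlarging the error. The threshold \<open>p0\<close> depends on neither the length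
  \<open>N\<close> nor the sequence, which is what allows a passage to infinite orbits.\<close>

lemma finite_shadowing:
  fixes W :: "'a::{topological_group_add, t2_space} set"
  assumes \<alpha>: "continuous_endomorphism \<alpha>"
    and W: "additive_subgroup W" "open W" "compact W"
  obtains p0 where "\<And>p x N. p0 \<le> p \<Longrightarrow>
    \<forall>k<N. - \<alpha> (x k) + x (Suc k) \<in> stay \<alpha> W p \<Longrightarrow>
    \<exists>z. \<forall>k\<le>N. - (\<alpha> ^^ k) z + x k \<in> stay \<alpha> W p"
proof -
  note hom = continuous_endomorphism_add[OF continuous_endomorphism_funpow[OF \<alpha>]]
    continuous_endomorphism_minus[OF continuous_endomorphism_funpow[OF \<alpha>]]
    continuous_endomorphism_add[OF \<alpha>] continuous_endomorphism_minus[OF \<alpha>]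
  obtain p0 where p0: "\<And>p n a. p0 \<le> p \<Longrightarrow> a \<in> stay \<alpha> W p \<Longrightarrow>
    \<exists>b\<in>stay \<alpha> W (p + n). - (\<alpha> ^^ (Suc (p + n))) b + (\<alpha> ^^ (Suc p)) a \<in> W"
    using stay_image_stabilises[OF \<alpha> W] by blast
  have "\<exists>z. \<forall>k\<le>N. - (\<alpha> ^^ k) z + x k \<in> stay \<alpha> W p"
    if p: "p0 \<le> p" and x: "\<forall>k<N. - \<alpha> (x k) + x (Suc k) \<in> stay \<alpha> W p" for p x N
    using x
  proof (induction N)
    case 0
    have "- (\<alpha> ^^ 0) (x 0) + x 0 \<in> stay \<alpha> W p"
      using additive_subgroup_zero[OF additive_subgroup_stay[OF \<alpha> W(1)]] by simp
    then show ?case by blast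
  next
    case (Suc N)
    note sub = additive_subgroup_stay[OF \<alpha> W(1), of p]
    obtain z where z: "\<And>k. k \<le> N \<Longrightarrow> - (\<alpha> ^^ k) z + x k \<in> stay \<alpha> W p"
      using Suc by auto
    \<comment> \<open>Here \<open>u\<close> is the shadowing error at time \<open>N\<close> and
      \<open>v\<close> the jump of the pseudo-orbit from time \<open>N\<close> to
      \<open>N + 1\<close>.\<close>
    define u where "u = - (\<alpha> ^^ N) z + x N"
    define v where "v = - \<alpha> (x N) + x (Suc N)"
    have u: "u \<in> stay \<alpha> W p" and v: "v \<in> stay \<alpha> W p"
      using z Suc.prems by (auto simp: u_def v_def)
    obtain b where b: "b \<in> stay \<alpha> W (p + N)"
      and bu: "- (\<alpha> ^^ (Suc (p + N))) b + (\<alpha> ^^ (Suc p)) u \<in> W"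
      using p0[OF p u] by blast
    have shift: "(\<alpha> ^^ k) b \<in> stay \<alpha> W p" if "k \<le> N" for k
      using b that by (auto simp: stay_def simp flip: funpow_add comp_apply[of "\<alpha> ^^ _"])
    \<comment> \<open>Replacing \<open>z\<close> by \<open>z + b\<close> multiplies each earlier
      error on the left by the inverse of \<open>(\<alpha> ^^ k) b\<close>, which lies in
      \<open>stay \<alpha> W p\<close> for \<open>k \<le> N\<close>. The new error at time
      \<open>N + 1\<close> is \<open>- (\<alpha> ^^ Suc N) b + \<alpha> u + v\<close>.\<close>
    have "- (\<alpha> ^^ k) (z + b) + x k \<in> stay \<alpha> W p" if "k \<le> Suc N" for k
    proof (cases "k \<le> N")
      case True
      have "- (\<alpha> ^^ k) b + (- (\<alpha> ^^ k) z + x k) \<in> stay \<alpha> W p"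
        using True shift z sub additive_subgroup_minus_add by blast
      then show ?thesis
        by (simp add: hom minus_add add.assoc del: add_uminus_conv_diff)
    next
      case False
      \<comment> \<open>For \<open>i < p\<close> both terms are in \<open>W\<close> by the staying
        conditions on \<open>b\<close> and \<open>u\<close>. Only \<open>i = p\<close> goes one step
        beyond them, and there the choice of \<open>b\<close> makes the difference lie in
        \<open>W\<close>.\<close>
      have "(\<alpha> ^^ i) (- (\<alpha> ^^ Suc N) b + \<alpha> u) \<in> W" if "i \<le> p" for i
      proof -
        have eq: "(\<alpha> ^^ i) (- (\<alpha> ^^ Suc N) b + \<alpha> u)
            = - (\<alpha> ^^ Suc (i + N)) b + (\<alpha> ^^ Suc i) u"
          by (simp add: hom funpow_add funpow_swap1)
        show ?thesis
        proof (cases "i = p")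
          case True
          then show ?thesis using bu eq by simp
        next
          case False
          then have "(\<alpha> ^^ Suc (i + N)) b \<in> W" "(\<alpha> ^^ Suc i) u \<in> W"
            using b u \<open>i \<le> p\<close> unfolding stay_def by (auto simp del: funpow.simps)
          then show ?thesis
            unfolding eq using W(1) additive_subgroup_minus_add by blast
        qed
      qed
      then have "- (\<alpha> ^^ Suc N) b + \<alpha> u \<in> stay \<alpha> W p"
        by (simp add: stay_def)
      then have "- (\<alpha> ^^ Suc N) b + \<alpha> u + v \<in> stay \<alpha> W p"
        using v sub additive_subgroup_add by blast
      moreover have "k = Suc N" using False \<open>k \<le> Suc N\<close> by simp
      ultimately show ?thesis
        by (simp add: hom minus_add u_def v_def add.assoc del: add_uminus_conv_diff)
    qed
    then show ?case by blast
  qed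
  then show thesis using that by blast
qed

section \<open>From finite to infinite pseudo-orbits\<close>

lemma closed_shadow_set:
  fixes K :: "'a::{topological_group_add, t2_space} set"
  assumes "continuous_on UNIV f" "closed K"
  shows "closed {z. - f z + c \<in> K}"
proof -
  have "closed ((\<lambda>z. - f z + c) -` K)"
    by (intro closed_vimage continuous_intros assms)
  then show ?thesis by (simp add: vimage_def)
qed

text \<open>Points shadowing at time \<open>0\<close> form a translate of the compact set \<open>- K\<close>, so shadowing of
  finite pieces passes to whole orbits.\<close>

lemma shadowing_limit:
  fixes K :: "'a::{topological_group_add, t2_space} set" and f :: "'b \<Rightarrow> 'a \<Rightarrow> 'a"
  assumes cont: "\<And>k. continuous_on UNIV (f k)" and K: "compact K"
    and i0: "f i0 = (\<lambda>z. z)" "i0 \<in> I 0" and I: "incseq I" "(\<Union>N::nat. I N) = UNIV"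
    and fin: "\<And>N. \<exists>z. \<forall>k\<in>I N. - f k z + x k \<in> K"
  shows "\<exists>z. \<forall>k. - f k z + x k \<in> K"
proof -
  define S where "S N = {z. \<forall>k\<in>I N. - f k z + x k \<in> K}" for N
  have "closed (S N)" for N
  proof -
    have S_eq: "S N = (\<Inter>k\<in>I N. {z. - f k z + x k \<in> K})"
      by (auto simp: S_def)
    show ?thesis
      unfolding S_eq by (intro closed_INT ballI closed_shadow_set cont compact_imp_closed K)
  qed
  moreover have "S N \<subseteq> (\<lambda>u. x i0 - u) ` K" for N
  proof
    fix z assume "z \<in> S N"
    moreover have "i0 \<in> I N" using i0(2) I(1) by (auto simp: incseq_def)
    ultimately have "- z + x i0 \<in> K" by (auto simp: S_def i0(1))
    moreover have "z = x i0 - (- z + x i0)"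
      by (simp add: diff_add_eq_diff_diff_swap)
    ultimately show "z \<in> (\<lambda>u. x i0 - u) ` K" by blast
  qed
  moreover have "compact ((\<lambda>u. x i0 - u) ` K)"
    by (intro compact_continuous_image continuous_intros K)
  ultimately have "compact (S N)" for N
    using compact_Int_closed[of "(\<lambda>u. x i0 - u) ` K" "S N"] by (metis inf.absorb2)
  moreover have "S N \<noteq> {}" for N using fin by (auto simp: S_def)
  moreover have "decseq S" using I(1) by (fastforce simp: S_def incseq_def decseq_def)
  ultimately have "(\<Inter>N. S N) \<noteq> {}" by (rule compact_decseq_Inter_nonempty)
  then obtain z where "\<forall>N. z \<in> S N" by blast
  then have "\<forall>k. - f k z + x k \<in> K"
    using I(2) unfolding S_def by blast
  then show ?thesis ..
qed

section \<open>Shadowing for positively expansive endomorphisms\<close>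

lemma positively_expansive_imp_shadowing:
  fixes \<alpha> :: "'a::{topological_group_add, t2_space} \<Rightarrow> 'a"
  assumes td: "totally_disconnected_space (euclidean :: 'a topology)"
    and lc: "locally_compact_space (euclidean :: 'a topology)"
    and \<alpha>: "continuous_endomorphism \<alpha>" and exp: "positively_expansive \<alpha>"
  shows "has_shadowing \<alpha>"
  unfolding has_shadowing_def
proof (intro allI impI)
  fix U :: "'a set" assume U: "nbhd_of_identity U"
  obtain E where E: "nbhd_of_identity E" "(\<Inter>n::nat. (\<alpha> ^^ n) -` E) = {0}"
    using exp by (auto simp: positively_expansive_def)
  obtain W where W: "additive_subgroup W" "open W" "compact W" "W \<subseteq> E"
    using van_Dantzig[OF td lc E(1)] .
  obtain p0 where p0: "\<And>p x N. p0 \<le> p \<Longrightarrow>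
    \<forall>k<N. - \<alpha> (x k) + x (Suc k) \<in> stay \<alpha> W p \<Longrightarrow>
    \<exists>z. \<forall>k\<le>N. - (\<alpha> ^^ k) z + x k \<in> stay \<alpha> W p"
    using finite_shadowing[OF \<alpha> W(1-3)] by blast
  \<comment> \<open>Expansivity enters here: the compact subgroups \<open>stay \<alpha> W n\<close>
    shrink to \<open>{0}\<close>, so one of them fits into \<open>interior U\<close>.\<close>
  have "(\<Inter>n. stay \<alpha> W n) \<subseteq> (\<Inter>n. (\<alpha> ^^ n) -` E)"
    using W(4) by (auto simp: stay_def)
  then have "(\<Inter>n. stay \<alpha> W n) \<subseteq> interior U"
    using E(2) U by (auto simp: nbhd_of_identity_def)
  then obtain q where q: "stay \<alpha> W q \<subseteq> interior U"
    using compact_decseq_Inter_subset_open[OF compact_stay[OF \<alpha> W(3)] decseq_stay open_interior]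
    by blast
  define p where "p = max p0 q"
  have pU: "stay \<alpha> W p \<subseteq> U"
    using q decseq_stay[of \<alpha> W] interior_subset[of U] unfolding p_def decseq_def
    by (meson max.cobounded2 order_trans)
  show "\<exists>V. nbhd_of_identity V \<and> (\<forall>x. pseudo_orbit \<alpha> V x \<longrightarrow> (\<exists>z. shadowed_by \<alpha> U x z))"
  \<comment> \<open>The same subgroup bounds the jumps and the shadowing errors.\<close>
  proof (rule exI[of _ "stay \<alpha> W p"], intro conjI allI impI)
    show "nbhd_of_identity (stay \<alpha> W p)"
      unfolding nbhd_of_identity_def interior_open[OF open_stay[OF \<alpha> W(2)]]
      by (rule additive_subgroup_zero[OF additive_subgroup_stay[OF \<alpha> W(1)]])
    fix x assume x: "pseudo_orbit \<alpha> (stay \<alpha> W p) x"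
    have "\<exists>z. \<forall>k. - (\<alpha> ^^ k) z + x k \<in> stay \<alpha> W p"
    proof (rule shadowing_limit)
      show "\<exists>z. \<forall>k\<in>{..N}. - (\<alpha> ^^ k) z + x k \<in> stay \<alpha> W p" for N
        using p0[of p N x] x by (auto simp: p_def pseudo_orbit_def)
      show "\<alpha> ^^ 0 = (\<lambda>z. z)" "(0::nat) \<in> {..0}"
        by auto
    qed (auto simp: incseq_def intro: continuous_endomorphism_continuous_on
        continuous_endomorphism_funpow \<alpha> compact_stay W)
    then show "\<exists>z. shadowed_by \<alpha> U x z"
      using pU by (auto simp: shadowed_by_def)
  qed
qed

section \<open>Integer iterates and the two-sided case\<close>

lemma int_iterate_of_nat: "int_iterate \<alpha> (int n) = \<alpha> ^^ n"
  by (simp add: int_iterate_def)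

lemma int_iterate_minus_of_nat: "int_iterate \<alpha> (- int n) = inv \<alpha> ^^ n"
  by (cases "n = 0") (simp_all add: int_iterate_def)

lemma int_iterate_add_one:
  assumes "bij \<alpha>"
  shows "int_iterate \<alpha> (k + 1) x = \<alpha> (int_iterate \<alpha> k x)"
proof (cases "0 \<le> k")
  case True
  then have "nat (k + 1) = Suc (nat k)" by simp
  then show ?thesis using True by (simp add: int_iterate_def)
next
  case False
  define m where "m = nat (- (k + 1))"
  have m: "k = - int (Suc m)" using False by (simp add: m_def)
  then have "int_iterate \<alpha> (k + 1) = inv \<alpha> ^^ m"
    using int_iterate_minus_of_nat[of \<alpha> m] by simp
  moreover have "\<alpha> (inv \<alpha> y) = y" for y
    using assms by (simp add: bij_is_surj surj_f_inv_f)
  ultimately show ?thesis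
    by (simp add: m int_iterate_minus_of_nat del: of_nat_Suc)
qed

text \<open>Induction on \<open>i\<close> in both directions from \<open>0\<close> avoids a case
  split on signs. The downward step compares the two sides after applying \<open>\<alpha>\<close>
  and cancels it by injectivity.\<close>

lemma int_iterate_add:
  assumes "bij \<alpha>"
  shows "int_iterate \<alpha> (i + j) x = int_iterate \<alpha> i (int_iterate \<alpha> j x)"
proof (induction i rule: int_induct[where k = 0])
  case base
  then show ?case by (simp add: int_iterate_def)
next
  case (step1 i)
  then show ?case
    using int_iterate_add_one[OF assms, of "i + j"] int_iterate_add_one[OF assms, of i]
    by (simp add: algebra_simps)
next
  case (step2 i)
  have "\<alpha> (int_iterate \<alpha> (i - 1 + j) x) = \<alpha> (int_iterate \<alpha> (i - 1) (int_iterate \<alpha> j x))"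
    using int_iterate_add_one[OF assms, of "i - 1 + j" x]
      int_iterate_add_one[OF assms, of "i - 1"] step2
    by (simp add: algebra_simps)
  then show ?case using assms by (simp add: bij_is_inj inj_eq)
qed

lemma topological_automorphism_imp_bij: "topological_automorphism \<alpha> \<Longrightarrow> bij \<alpha>"
  unfolding topological_automorphism_def homeomorphism_def
  by (metis UNIV_I bij_betw_byWitness subset_UNIV)

lemma topological_automorphism_imp_endomorphism:
  "topological_automorphism \<alpha> \<Longrightarrow> continuous_endomorphism \<alpha>"
  by (auto simp: topological_automorphism_def continuous_endomorphism_def homeomorphism_def)

lemma continuous_endomorphism_int_iterate:
  assumes "topological_automorphism \<alpha>"
  shows "continuous_endomorphism (int_iterate \<alpha> k)"
proof -
  note bij = topological_automorphism_imp_bij[OF assms]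
  have "inv \<alpha> (x + y) = inv \<alpha> x + inv \<alpha> y" for x y
    using bij assms unfolding topological_automorphism_def
    by (metis bij_inv_eq_iff)
  then have "continuous_endomorphism (inv \<alpha>)"
    using assms by (auto simp: topological_automorphism_def continuous_endomorphism_def
        homeomorphism_def)
  then show ?thesis
    using topological_automorphism_imp_endomorphism[OF assms]
    by (simp add: int_iterate_def continuous_endomorphism_funpow)
qed

text \<open>The images \<open>int_iterate \<alpha> m ` stay \<alpha> W (2 * m)\<close> are the points staying in \<open>W\<close> during
  times \<open>- m\<close> to \<open>m\<close>; shadowing with respect to them is shadowing with respect to
  \<open>stay \<alpha> W (2 * m)\<close>, conjugated by \<open>\<alpha> ^^ m\<close>.\<close>

lemma expansive_imp_two_sided_shadowing:
  fixes \<alpha> :: "'a::{topological_group_add, t2_space} \<Rightarrow> 'a"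
  assumes td: "totally_disconnected_space (euclidean :: 'a topology)"
    and lc: "locally_compact_space (euclidean :: 'a topology)"
    and \<alpha>: "topological_automorphism \<alpha>" and exp: "expansive \<alpha>"
  shows "has_two_sided_shadowing \<alpha>"
  unfolding has_two_sided_shadowing_def
proof (intro allI impI)
  note endo = topological_automorphism_imp_endomorphism[OF \<alpha>]
  note iter_add = int_iterate_add[OF topological_automorphism_imp_bij[OF \<alpha>]]
  note iter_endo = continuous_endomorphism_int_iterate[OF \<alpha>]
  note hom = continuous_endomorphism_add[OF iter_endo] continuous_endomorphism_minus[OF iter_endo]
  have iter_one: "int_iterate \<alpha> 1 = \<alpha>" by (simp add: int_iterate_def)
  have iter_zero: "int_iterate \<alpha> 0 = (\<lambda>z. z)" by (simp add: int_iterate_def id_def)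
  fix U :: "'a set" assume U: "nbhd_of_identity U"
  obtain E where E: "nbhd_of_identity E" "(\<Inter>n::int. int_iterate \<alpha> n -` E) = {0}"
    using exp by (auto simp: expansive_def)
  obtain W where W: "additive_subgroup W" "open W" "compact W" "W \<subseteq> E"
    using van_Dantzig[OF td lc E(1)] .
  obtain p0 where p0: "\<And>p x N. p0 \<le> p \<Longrightarrow>
    \<forall>k<N. - \<alpha> (x k) + x (Suc k) \<in> stay \<alpha> W p \<Longrightarrow>
    \<exists>z. \<forall>k\<le>N. - (\<alpha> ^^ k) z + x k \<in> stay \<alpha> W p"
    using finite_shadowing[OF endo W(1-3)] by blast
  \<comment> \<open>Writing the image under \<open>\<alpha> ^^ m\<close> as a preimage under its
    inverse gives closedness and openness directly from continuity.\<close>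
  define B where "B m = int_iterate \<alpha> (- int m) -` stay \<alpha> W (2 * m)" for m
  have B_iff: "x \<in> B m \<longleftrightarrow> (\<forall>k. \<bar>k\<bar> \<le> int m \<longrightarrow> int_iterate \<alpha> k x \<in> W)" for x m
  proof
    assume x: "x \<in> B m"
    show "\<forall>k. \<bar>k\<bar> \<le> int m \<longrightarrow> int_iterate \<alpha> k x \<in> W"
    proof (intro allI impI)
      fix k assume k: "\<bar>k\<bar> \<le> int m"
      then have "(\<alpha> ^^ nat (k + int m)) (int_iterate \<alpha> (- int m) x) \<in> W"
        using x by (auto simp: B_def stay_def)
      then have "int_iterate \<alpha> (k + int m) (int_iterate \<alpha> (- int m) x) \<in> W"
        using k unfolding int_iterate_def[of _ "k + int m"] by (simp add: abs_le_iff)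
      then show "int_iterate \<alpha> k x \<in> W" by (simp flip: iter_add)
    qed
  next
    assume *: "\<forall>k. \<bar>k\<bar> \<le> int m \<longrightarrow> int_iterate \<alpha> k x \<in> W"
    show "x \<in> B m"
      using * by (auto simp: B_def stay_def simp flip: iter_add int_iterate_of_nat)
  qed
  have compact_B: "compact (B m)" for m
  proof -
    have "closed (B m)"
      unfolding B_def
      by (intro closed_vimage compact_imp_closed compact_stay endo W
          continuous_endomorphism_continuous_on iter_endo)
    moreover have "B m \<subseteq> W"
      using iter_zero by (force simp: B_iff dest: spec[of _ 0])
    ultimately show ?thesis
      using compact_Int_closed[OF W(3)] by (metis inf.absorb2)
  qed
  have decseq_B: "decseq B"
    by (auto simp: decseq_def B_iff)
  have "(\<Inter>m. B m) \<subseteq> (\<Inter>n::int. int_iterate \<alpha> n -` E)"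
  proof (intro subsetI INT_I)
    fix x n assume "x \<in> (\<Inter>m. B m)"
    then have "x \<in> B (nat \<bar>n\<bar>)" by blast
    then show "x \<in> int_iterate \<alpha> n -` E" using W(4) by (auto simp: B_iff)
  qed
  then have "(\<Inter>m. B m) \<subseteq> interior U"
    using E(2) U by (auto simp: nbhd_of_identity_def)
  then obtain q where q: "B q \<subseteq> interior U"
    using compact_decseq_Inter_subset_open[OF compact_B decseq_B open_interior] by blast
  define m where "m = max p0 q"
  have mU: "B m \<subseteq> U"
    using q decseq_B interior_subset[of U] unfolding m_def decseq_def
    by (meson max.cobounded2 order_trans)
  show "\<exists>V. nbhd_of_identity V \<and> (\<forall>x. (\<forall>k. - \<alpha> (x k) + x (k + 1) \<in> V) \<longrightarrow>
      (\<exists>z. \<forall>k. - int_iterate \<alpha> k z + x k \<in> U))"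
  proof (rule exI[of _ "B m"], intro conjI allI impI)
    have "open (B m)"
      unfolding B_def
      by (intro open_vimage open_stay endo W continuous_endomorphism_continuous_on iter_endo)
    moreover have "0 \<in> B m"
      by (simp add: B_iff continuous_endomorphism_zero[OF iter_endo] additive_subgroup_zero W)
    ultimately show "nbhd_of_identity (B m)"
      by (simp add: nbhd_of_identity_def interior_open)
    fix x :: "int \<Rightarrow> 'a" assume x: "\<forall>k. - \<alpha> (x k) + x (k + 1) \<in> B m"
    have "\<exists>z. \<forall>k. - int_iterate \<alpha> k z + x k \<in> B m"
    proof (rule shadowing_limit)
      show "\<exists>z. \<forall>k\<in>{- int N..int N}. - int_iterate \<alpha> k z + x k \<in> B m" for N
      proof -
        \<comment> \<open>Shifting time by \<open>N\<close> turns the window from \<open>- N\<close>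
          to \<open>N\<close> into \<open>0\<close> to \<open>2 * N\<close>. Applying the iterate
          \<open>- m\<close> turns jumps in \<open>B m\<close> into jumps in
          \<open>stay \<alpha> W (2 * m)\<close>.\<close>
        define y where "y j = int_iterate \<alpha> (- int m) (x (int j - int N))" for j
        have "- \<alpha> (y j) + y (Suc j) \<in> stay \<alpha> W (2 * m)" for j
        proof -
          have "\<alpha> (y j) = int_iterate \<alpha> (- int m) (\<alpha> (x (int j - int N)))"
            using iter_add[of 1 "- int m"] iter_add[of "- int m" 1]
            by (simp add: y_def iter_one add.commute)
          moreover have "int (Suc j) - int N = int j - int N + 1" by simp
          ultimately have "- \<alpha> (y j) + y (Suc j)
              = int_iterate \<alpha> (- int m) (- \<alpha> (x (int j - int N)) + x (int j - int N + 1))"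
            unfolding y_def hom by metis
          then show ?thesis using x by (simp add: B_def)
        qed
        moreover have "p0 \<le> 2 * m" by (simp add: m_def)
        ultimately obtain z where z: "\<And>j. j \<le> 2 * N \<Longrightarrow> - (\<alpha> ^^ j) z + y j \<in> stay \<alpha> W (2 * m)"
          using p0[of "2 * m" "2 * N" y] by blast
        \<comment> \<open>The point \<open>z\<close> sits at time \<open>- N\<close> of the
          conjugated sequence: the exponent \<open>int N\<close> moves it to time \<open>0\<close>,
          and \<open>int m\<close> undoes the conjugation.\<close>
        have "- int_iterate \<alpha> k (int_iterate \<alpha> (int N + int m) z) + x k \<in> B m"
          if "k \<in> {- int N..int N}" for k
        proof -
          define j where "j = nat (k + int N)"
          have j: "k = int j - int N" "j \<le> 2 * N" using that by (auto simp: j_def)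
          have "int_iterate \<alpha> (- int m) (int_iterate \<alpha> k (int_iterate \<alpha> (int N + int m) z))
              = (\<alpha> ^^ j) z"
            by (simp add: j(1) flip: iter_add int_iterate_of_nat)
          then show ?thesis
            using z[OF j(2)] by (simp add: B_def hom y_def flip: j(1))
        qed
        then show ?thesis by blast
      qed
      show "(\<Union>N. {- int N..int N}) = UNIV"
      proof safe
        fix k :: int
        have "k \<in> {- int (nat \<bar>k\<bar>)..int (nat \<bar>k\<bar>)}" by auto
        then show "k \<in> (\<Union>N. {- int N..int N})" by blast
      qed simp
    qed (auto simp: incseq_def iter_zero
        intro: continuous_endomorphism_continuous_on iter_endo compact_B)
    then show "\<exists>z. \<forall>k. - int_iterate \<alpha> k z + x k \<in> U"
      using mU by blast
  qed
qed

theorem corollary3p4: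
  assumes "totally_disconnected_space (euclidean :: 'a::{topological_group_add, t2_space} topology)"
    and "locally_compact_space (euclidean :: 'a topology)"
  shows "(\<forall>\<alpha> :: 'a \<Rightarrow> 'a. continuous_endomorphism \<alpha> \<longrightarrow>
            (topologically_expanding \<alpha> \<longleftrightarrow> positively_expansive \<alpha>)) \<and>
         (\<forall>\<alpha> :: 'a \<Rightarrow> 'a. topological_automorphism \<alpha> \<longrightarrow>
            (topologically_Anosov \<alpha> \<longleftrightarrow> expansive \<alpha>))"
  unfolding topologically_expanding_def topologically_Anosov_def
  using positively_expansive_imp_shadowing[OF assms] expansive_imp_two_sided_shadowing[OF assms]
  by blast

end
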